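(* Let $G$ and $H$ be finite simple graphs on a common vertex set $V$ with $\deg_G(v)=\deg_H(v)$ for all $v\in V$, with adjacency matrices $A$ and $B$. Let $V=\bigsqcup_{i=1}^pV_i$ be the partition of $V$ by degree, $e_i\in\{0,1\}^V$ the characteristic vector of $V_i$, $J_{i,j}=e_ie_j^\top$, and $D_i$ the diagonal $0/1$ matrix with $D_i(v,v)=1$ iff $v\in V_i$. With indeterminates $s_0,s_1,\dots,s_p$ and $s_{i,j}$ ($1\le i,j\le p$), define - $A'=s_0A+s_1D_1+\cdots+s_pD_p$ and $B'=s_0B+s_1D_1+\cdots+s_pD_p$; - $A''=s_0A+s_1J_{1,1}+\cdots+s_pJ_{p,p}$ and $B''=s_0B+s_1J_{1,1}+\cdots+s_pJ_{p,p}$; - $A'''=s_0A+\sum_{i,j=1}^ps_{i,j}J_{i,j}$ and $B'''=s_0B+\sum_{i,j=1}^ps_{i,j}J_{i,j}$. Then the following are equivalent: (1) $I_{A,2}(t)=I_{B,2}(t)$; (2) $I_{A',2}(t)=I_{B',2}(t)$; (3) $I_{A'',2}(t)=I_{B'',2}(t)$; (4) $I_{A''',2}(t)=I_{B''',2}(t)$.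
   Context: The matrices $A',\dots,B'''$ have entries in the polynomial ring over the indeterminates. WL invariants of a matrix $M:V\times V\to C$: the atomic type $\mathrm{tp}_M(i_1,\dots,i_k)$ is the $k\times k$ array $T$ with $T_{a,b}=(0,M(i_a,i_b))$ if $i_a=i_b$ and $(1,M(i_a,i_b))$ otherwise; $X^1_{M,2}=\mathrm{tp}_M$ on pairs and $X^{r+1}_{M,2}(i,j)=\big(X^r_{M,2}(i,j),\{\!\{(\mathrm{tp}_M(i,j,m),X^r_{M,2}(i,m),X^r_{M,2}(m,j)):m\in V\}\!\}\big)$ ($\{\!\{\cdot\}\!\}$ a multiset; colors are abstract objects built this way, comparable across matrices). $M^r_{M,2}=\{\!\{X^r_{M,2}(x):x\in V^2\}\!\}$ and $I_{M,2}(t)=\sum_{r\ge1}t^rM^r_{M,2}$ as a formal series. *)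

theory Defs
  imports
    "HOL-Library.Multiset"
    "HOL-Library.Poly_Mapping"
    "HOL-Computational_Algebra.Formal_Power_Series"
    "Graph_Theory.Pair_Digraph"
begin

section \<open>Weisfeiler--Leman invariants of a matrix\<close>

text \<open>
  A matrix \<open>V \<times> V \<rightarrow> C\<close> is a function \<open>'v \<Rightarrow> 'v \<Rightarrow> 'c\<close> together with the carrier \<open>V\<close>;
  its values outside \<open>V\<close> are never used.
  The atomic type of a tuple is the array of its entries, stored as the list of its rows.
\<close>

type_synonym 'c atomic_type = "(nat \<times> 'c) list list"

definition tp :: "('v \<Rightarrow> 'v \<Rightarrow> 'c) \<Rightarrow> 'v list \<Rightarrow> 'c atomic_type" where
  "tp M is = map (\<lambda>x. map (\<lambda>y. (if x = y then 0 else 1, M x y)) is) is"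

text \<open>
  Colors are free terms over atomic types, pairing and multisets; they do not mention the matrix
  or its index set, so colors arising from different matrices can be compared.
\<close>

datatype 'c wl_color =
    Atomic "'c atomic_type"
  | Refined "'c wl_color" "('c atomic_type \<times> 'c wl_color \<times> 'c wl_color) multiset"

text \<open>The rounds are counted from 1 on paper: \<open>wl_coloring V M n\<close> is $X^{n+1}_{M,2}$.\<close>

primrec wl_coloring :: "'v set \<Rightarrow> ('v \<Rightarrow> 'v \<Rightarrow> 'c) \<Rightarrow> nat \<Rightarrow> 'v \<Rightarrow> 'v \<Rightarrow> 'c wl_color" where
  "wl_coloring V M 0 = (\<lambda>i j. Atomic (tp M [i, j]))"
| "wl_coloring V M (Suc n) = (\<lambda>i j.
     Refined (wl_coloring V M n i j)
       {# (tp M [i, j, m], wl_coloring V M n i m, wl_coloring V M n m j). m \<in># mset_set V #})"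

text \<open>Likewise, \<open>wl_multiset V M n\<close> is $M^{n+1}_{M,2}$.\<close>

definition wl_multiset :: "'v set \<Rightarrow> ('v \<Rightarrow> 'v \<Rightarrow> 'c) \<Rightarrow> nat \<Rightarrow> 'c wl_color multiset" where
  "wl_multiset V M n = {# wl_coloring V M n i j. (i, j) \<in># mset_set (V \<times> V) #}"

text \<open>The coefficient of \<open>t ^ r\<close> is $M^r_{M,2}$ for \<open>r \<ge> 1\<close>; there is no constant term.\<close>

definition wl_series :: "'v set \<Rightarrow> ('v \<Rightarrow> 'v \<Rightarrow> 'c) \<Rightarrow> 'c wl_color multiset fps" where
  "wl_series V M = Abs_fps (\<lambda>r. case r of 0 \<Rightarrow> 0 | Suc n \<Rightarrow> wl_multiset V M n)"


section \<open>Graphs and their partition by degree\<close>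

text \<open>
  A finite simple graph is a \<^const>\<open>pair_graph\<close>: each edge is represented by its two
  opposite arcs, so the degree of a vertex is its out-degree.
\<close>

abbreviation deg :: "'v pair_pre_digraph \<Rightarrow> 'v \<Rightarrow> nat" where
  "deg G v \<equiv> out_degree (with_proj G) v"

definition adj_mat :: "'v pair_pre_digraph \<Rightarrow> 'v \<Rightarrow> 'v \<Rightarrow> 'r::zero_neq_one" where
  "adj_mat G u v = (if (u, v) \<in> parcs G then 1 else 0)"

definition degree_classes :: "'v pair_pre_digraph \<Rightarrow> 'v set set" where
  "degree_classes G =
     pverts G // {(u, v). u \<in> pverts G \<and> v \<in> pverts G \<and> deg G u = deg G v}"

definition char_vec :: "'v set \<Rightarrow> 'v \<Rightarrow> 'r::zero_neq_one" where
  "char_vec S v = (if v \<in> S then 1 else 0)"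

definition J_mat :: "(nat \<Rightarrow> 'v set) \<Rightarrow> nat \<Rightarrow> nat \<Rightarrow> 'v \<Rightarrow> 'v \<Rightarrow> 'r::comm_ring_1" where
  "J_mat P i j u v = char_vec (P i) u * char_vec (P j) v"

definition D_mat :: "(nat \<Rightarrow> 'v set) \<Rightarrow> nat \<Rightarrow> 'v \<Rightarrow> 'v \<Rightarrow> 'r::zero_neq_one" where
  "D_mat P i u v = (if u = v \<and> v \<in> P i then 1 else 0)"


section \<open>Matrices over the polynomial ring\<close>

text \<open>
  \<open>Ind i\<close> stands for $s_i$ and \<open>Ind2 i j\<close> for $s_{i,j}$. A polynomial is a finitely supported map
  from monomials (finitely supported exponent vectors) to coefficients.
\<close>

datatype indet = Ind nat | Ind2 nat nat

type_synonym 'k mpoly = "(indet \<Rightarrow>\<^sub>0 nat) \<Rightarrow>\<^sub>0 'k"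

definition var :: "indet \<Rightarrow> 'k::comm_ring_1 mpoly" where
  "var x = Poly_Mapping.single (Poly_Mapping.single x 1) 1"

text \<open>
  For \<open>M = A\<close> the next three definitions give $A'$, $A''$ and $A'''$; \<open>P 1, \<dots>, P p\<close> are the
  parts $V_1,\dots,V_p$.
\<close>

definition mat_diag ::
  "nat \<Rightarrow> (nat \<Rightarrow> 'v set) \<Rightarrow> ('v \<Rightarrow> 'v \<Rightarrow> 'k mpoly) \<Rightarrow> 'v \<Rightarrow> 'v \<Rightarrow> 'k::comm_ring_1 mpoly" where
  "mat_diag p P M u v =
     var (Ind 0) * M u v + (\<Sum>i = 1..p. var (Ind i) * D_mat P i u v)"

definition mat_diag_blocks ::
  "nat \<Rightarrow> (nat \<Rightarrow> 'v set) \<Rightarrow> ('v \<Rightarrow> 'v \<Rightarrow> 'k mpoly) \<Rightarrow> 'v \<Rightarrow> 'v \<Rightarrow> 'k::comm_ring_1 mpoly" where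
  "mat_diag_blocks p P M u v =
     var (Ind 0) * M u v + (\<Sum>i = 1..p. var (Ind i) * J_mat P i i u v)"

definition mat_all_blocks ::
  "nat \<Rightarrow> (nat \<Rightarrow> 'v set) \<Rightarrow> ('v \<Rightarrow> 'v \<Rightarrow> 'k mpoly) \<Rightarrow> 'v \<Rightarrow> 'v \<Rightarrow> 'k::comm_ring_1 mpoly" where
  "mat_all_blocks p P M u v =
     var (Ind 0) * M u v + (\<Sum>i = 1..p. \<Sum>j = 1..p. var (Ind2 i j) * J_mat P i j u v)"

end

theory Submission
  imports Defs
begin

text \<open>
  Each of the three matrices over the polynomial ring is determined entrywise by the adjacency
  matrix, equality of indices and the degrees of the two indices, and conversely the coefficient of
  \<open>s\<^sub>0\<close> gives back the adjacency matrix. Degrees are visible in the second round of the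
  refinement, so colors of round \<open>r + 1\<close> of the adjacency matrix determine colors of round \<open>r\<close> of
  the other matrices.
\<close>

text \<open>Equal images amount to a matching of \<open>S\<close> with \<open>T\<close> along which
  \<open>f\<close> and \<open>g\<close> agree, expressed by \<open>rel_mset\<close>. The second
  assumption makes \<open>h\<close> and \<open>k\<close> agree along the same matching.\<close>

lemma image_mset_eq_transfer:
  assumes "image_mset f S = image_mset g T"
    and "\<And>x y. x \<in># S \<Longrightarrow> y \<in># T \<Longrightarrow> f x = g y \<Longrightarrow> h x = k y"
  shows "image_mset h S = image_mset k T"
proof -
  have "rel_mset (\<lambda>x y. f x = g y) S T"
    using assms(1) multiset.rel_map(1)[of "(=)" f S "image_mset g T"] multiset.rel_map(2)[of "\<lambda>x. (=) (f x)" S g T]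
    by (simp add: multiset.rel_eq)
  then have "rel_mset (\<lambda>x y. h x = k y) S T"
    by (rule multiset.rel_mono_strong) (use assms(2) in auto)
  then show ?thesis
    using multiset.rel_map(1)[of "(=)" h S "image_mset k T"] multiset.rel_map(2)[of "\<lambda>x. (=) (h x)" S k T]
    by (simp add: multiset.rel_eq)
qed

text \<open>A refined color carries the color of the preceding round as its first component, and
  constructors are injective.\<close>

lemma wl_coloring_eq_antimono:
  assumes "wl_coloring V M n i j = wl_coloring V M' n i' j'" and "m \<le> n"
  shows "wl_coloring V M m i j = wl_coloring V M' m i' j'"
  using assms(2,1) by (induction rule: inc_induct) auto

text \<open>The common frame of all six implications: information about \<open>M\<close> and
  \<open>M'\<close> is carried over to \<open>N\<close> and \<open>N'\<close>. The relation
  \<open>R\<close> stands for what two rounds reveal about a single vertex; index 1 is the second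
  round because indices start at 0.\<close>

locale wl_simulation =
  fixes V :: "'v set" and M M' :: "'v \<Rightarrow> 'v \<Rightarrow> 'c" and N N' :: "'v \<Rightarrow> 'v \<Rightarrow> 'd"
    and R :: "'v \<Rightarrow> 'v \<Rightarrow> bool"
  assumes finite_V: "finite V"
    and round_two: "\<And>u v u' v'. \<lbrakk>u \<in> V; v \<in> V; u' \<in> V; v' \<in> V;
          wl_coloring V M 1 u v = wl_coloring V M' 1 u' v'\<rbrakk> \<Longrightarrow> R u u' \<and> R v v'"
    and entry: "\<And>u v u' v'. \<lbrakk>u \<in> V; v \<in> V; u' \<in> V; v' \<in> V; u = v \<longleftrightarrow> u' = v';
          M u v = M' u' v'; R u u'; R v v'\<rbrakk> \<Longrightarrow> N u v = N' u' v'"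
begin

lemma tp_eq:
  assumes "list_all2 R is is'" and "set is \<subseteq> V" and "set is' \<subseteq> V" and "tp M is = tp M' is'"
  shows "tp N is = tp N' is'"
proof -
  have len: "length is = length is'" using assms(1) by (rule list_all2_lengthD)
  have "(if is ! a = is ! b then 0 else 1 :: nat, N (is ! a) (is ! b)) =
        (if is' ! a = is' ! b then 0 else 1, N' (is' ! a) (is' ! b))"
    if "a < length is" "b < length is" for a b
  proof -
    have "tp M is ! a ! b = tp M' is' ! a ! b" using assms(4) by simp
    \<comment> \<open>The flag in each entry of an atomic type records whether the two indices
      coincide, which is the equality pattern required by \<open>entry\<close>.\<close>
    then have "(is ! a = is ! b) = (is' ! a = is' ! b)" "M (is ! a) (is ! b) = M' (is' ! a) (is' ! b)"
      using that len by (auto simp: tp_def split: if_splits)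
    moreover have "is ! a \<in> V" "is ! b \<in> V" "is' ! a \<in> V" "is' ! b \<in> V"
      using that len assms(2,3) by (auto dest: nth_mem)
    moreover have "R (is ! a) (is' ! a)" "R (is ! b) (is' ! b)"
      using assms(1) that by (auto dest: list_all2_nthD)
    ultimately show ?thesis using entry by auto
  qed
  then show ?thesis using len by (auto simp: tp_def intro!: nth_equalityI)
qed

text \<open>One round is lost because \<open>R\<close> can be read off only from the second round
  on. After that the induction runs in parallel on both sides.\<close>

lemma wl_coloring_eq:
  assumes "u \<in> V" "v \<in> V" "u' \<in> V" "v' \<in> V"
    and "wl_coloring V M (Suc n) u v = wl_coloring V M' (Suc n) u' v'"
  shows "wl_coloring V N n u v = wl_coloring V N' n u' v'"
  using assms
proof (induction n arbitrary: u v u' v')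
  case 0
  then have "R u u'" "R v v'" using round_two by auto
  with 0 show ?case by (auto intro!: tp_eq)
next
  case (Suc n)
  let ?f = "\<lambda>K u v m. (tp K [u, v, m], wl_coloring V K (Suc n) u m, wl_coloring V K (Suc n) m v)"
  let ?g = "\<lambda>K u v m. (tp K [u, v, m], wl_coloring V K n u m, wl_coloring V K n m v)"
  have "image_mset (?f M u v) (mset_set V) = image_mset (?f M' u' v') (mset_set V)"
    using Suc.prems(5) unfolding wl_coloring.simps(2)[of _ _ "Suc n"] by (simp del: wl_coloring.simps)
  then have "image_mset (?g N u v) (mset_set V) = image_mset (?g N' u' v') (mset_set V)"
  proof (rule image_mset_eq_transfer)
    fix m m' assume "m \<in># mset_set V" "m' \<in># mset_set V"
    then have m: "m \<in> V" "m' \<in> V" using finite_V by auto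
    assume eq: "?f M u v m = ?f M' u' v' m'"
    \<comment> \<open>The colors of the pairs through \<open>m\<close> have index
      \<open>Suc n\<close>, hence at least 1. So \<open>round_two\<close> applies to them and
      relates also the third vertices \<open>m\<close> and \<open>m'\<close>, as the atomic types of
      triples require.\<close>
    then have one: "wl_coloring V M 1 u m = wl_coloring V M' 1 u' m'"
        "wl_coloring V M 1 m v = wl_coloring V M' 1 m' v'"
      by (auto intro: wl_coloring_eq_antimono[of V _ "Suc n"] simp del: wl_coloring.simps)
    have "R u u'" "R v v'" "R m m'"
      using round_two[OF Suc.prems(1) m(1) Suc.prems(3) m(2) one(1)]
        round_two[OF m(1) Suc.prems(2) m(2) Suc.prems(4) one(2)] by auto
    then have "tp N [u, v, m] = tp N' [u', v', m']"
      using eq m Suc.prems by (intro tp_eq) auto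
    then show "?g N u v m = ?g N' u' v' m'"
      using eq m Suc.prems Suc.IH by (auto simp del: wl_coloring.simps)
  qed
  moreover have "wl_coloring V N n u v = wl_coloring V N' n u' v'"
    using Suc.prems by (intro Suc.IH wl_coloring_eq_antimono[of V _ "Suc (Suc n)" _ _ _ _ _ "Suc n"]) auto
  ultimately show ?case by simp
qed

lemma wl_multiset_eq:
  assumes "wl_multiset V M (Suc n) = wl_multiset V M' (Suc n)"
  shows "wl_multiset V N n = wl_multiset V N' n"
  using assms unfolding wl_multiset_def
  by (rule image_mset_eq_transfer)
    (use finite_V wl_coloring_eq in \<open>auto simp del: wl_coloring.simps\<close>)

end

lemma wl_series_eq_iff:
  "wl_series V M = wl_series V M' \<longleftrightarrow> (\<forall>n. wl_multiset V M n = wl_multiset V M' n)"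
  by (auto simp: wl_series_def fps_eq_iff split: nat.splits)

text \<open>Equality of the series gives all rounds at once, so the loss of one round does no
  harm.\<close>

lemma (in wl_simulation) wl_series_eq:
  "wl_series V M = wl_series V M' \<Longrightarrow> wl_series V N = wl_series V N'"
  using wl_multiset_eq by (simp add: wl_series_eq_iff)

text \<open>Counting the ones of a row, instead of adding its entries up in \<open>'k\<close>, gives
  the degree in every characteristic. Arcs end in \<open>pverts G\<close>, so none is
  missed.\<close>

lemma deg_eq_count_adj_mat:
  assumes "pair_graph G"
  shows "deg G u = count (image_mset (adj_mat G u) (mset_set (pverts G))) (1 :: 'k::zero_neq_one)"
proof -
  interpret pair_graph G by fact
  have "{m \<in> pverts G. adj_mat G u m = (1 :: 'k)} = {m. (u, m) \<in> parcs G}"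
    by (auto simp: adj_mat_def dest: in_arcsD2)
  moreover have "out_arcs (with_proj G) u = Pair u ` {m. (u, m) \<in> parcs G}"
    by (auto simp: out_arcs_def)
  ultimately show ?thesis
    by (simp add: out_degree_def count_image_mset_eq_card_vimage card_image inj_on_def)
qed

text \<open>The atomic type of the triple \<open>[u, v, m]\<close> contains the entries at
  \<open>(u, m)\<close> and \<open>(v, m)\<close>. Letting \<open>m\<close> range over
  \<open>V\<close>, the multiset in the second round determines the rows of \<open>u\<close> and of
  \<open>v\<close> up to order, and so both degrees.\<close>

lemma deg_eq_if_wl_coloring_eq:
  fixes G H :: "'v pair_pre_digraph"
  assumes "pair_graph G" "pair_graph H" "pverts G = V" "pverts H = V"
    and eq: "wl_coloring V (adj_mat G) 1 u v = wl_coloring V (adj_mat H :: _ \<Rightarrow> _ \<Rightarrow> 'k::zero_neq_one) 1 u' v'"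
  shows "deg G u = deg H u'" and "deg G v = deg H v'"
proof -
  let ?A = "adj_mat G :: 'v \<Rightarrow> 'v \<Rightarrow> 'k" and ?B = "adj_mat H :: 'v \<Rightarrow> 'v \<Rightarrow> 'k"
  let ?f = "\<lambda>K u v m. (tp K [u, v, m], wl_coloring V K 0 u m, wl_coloring V K 0 m v)"
  have *: "image_mset (?f ?A u v) (mset_set V) = image_mset (?f ?B u' v') (mset_set V)"
    using eq by simp
  have "image_mset (?A u) (mset_set V) = image_mset (?B u') (mset_set V)"
    by (rule image_mset_eq_transfer[OF *]) (auto simp: tp_def)
  moreover have "image_mset (?A v) (mset_set V) = image_mset (?B v') (mset_set V)"
    by (rule image_mset_eq_transfer[OF *]) (auto simp: tp_def)
  ultimately show "deg G u = deg H u'" and "deg G v = deg H v'"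
    using assms by (simp_all add: deg_eq_count_adj_mat[where 'k = 'k])
qed

lemma mem_degree_class_iff:
  assumes "S \<in> degree_classes G" "u \<in> pverts G" "v \<in> pverts G" "deg G u = deg G v"
  shows "u \<in> S \<longleftrightarrow> v \<in> S"
  using assms by (auto simp: degree_classes_def quotient_def)

lemma lookup_var [simp]: "Poly_Mapping.lookup (var x) (Poly_Mapping.single y (Suc 0)) = (if x = y then 1 else 0)"
  by (simp add: var_def lookup_single when_def) (metis lookup_single_eq lookup_single_not_eq nat.distinct(1))

text \<open>Limiting the factor to 0 and 1 avoids the convolution formula for the coefficients of a
  product.\<close>

lemma lookup_mult_01:
  assumes "c \<in> {0, 1}"
  shows "Poly_Mapping.lookup (var x * c) (Poly_Mapping.single y (Suc 0)) = (if x = y then (if c = 1 then 1 else 0) else 0)"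
  using assms by auto

text \<open>The common shape of the three matrices: one term at \<open>Ind 0\<close>, and further
  terms at other indeterminates that do not contribute to this coefficient.\<close>

lemma lookup_add_sum:
  fixes c :: "'k::comm_ring_1 mpoly"
  assumes "c \<in> {0, 1}"
    and "\<And>i. i \<in> I \<Longrightarrow> x i \<noteq> Ind 0 \<and> d i \<in> {0, 1}"
  shows "Poly_Mapping.lookup (var (Ind 0) * c + (\<Sum>i\<in>I. var (x i) * d i)) (Poly_Mapping.single (Ind 0) (Suc 0))
    = (if c = 1 then 1 else 0)"
  using assms by (simp add: lookup_add lookup_sum lookup_mult_01 sum.neutral del: insert_iff)

lemma adj_mat_01: "adj_mat G u v \<in> {0, 1}"
  by (simp add: adj_mat_def)

lemma J_mat_01: "J_mat P i j u v \<in> {0, 1}"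
  by (simp add: J_mat_def char_vec_def)

lemma D_mat_01: "D_mat P i u v \<in> {0, 1}"
  by (simp add: D_mat_def)

lemma lookup_mat_diag:
  "Poly_Mapping.lookup (mat_diag p P (adj_mat G) u v :: 'k::comm_ring_1 mpoly)
     (Poly_Mapping.single (Ind 0) (Suc 0)) = adj_mat G u v"
  unfolding mat_diag_def
  \<comment> \<open>The summation starts at 1, so \<open>Ind 0\<close> does not occur in the
    sum.\<close>
  by (subst lookup_add_sum[OF adj_mat_01]) (simp_all add: D_mat_01 adj_mat_def del: insert_iff)

lemma lookup_mat_diag_blocks:
  "Poly_Mapping.lookup (mat_diag_blocks p P (adj_mat G) u v :: 'k::comm_ring_1 mpoly)
     (Poly_Mapping.single (Ind 0) (Suc 0)) = adj_mat G u v"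
  unfolding mat_diag_blocks_def
  by (subst lookup_add_sum[OF adj_mat_01]) (simp_all add: J_mat_01 adj_mat_def del: insert_iff)

lemma lookup_mat_all_blocks:
  "Poly_Mapping.lookup (mat_all_blocks p P (adj_mat G) u v :: 'k::comm_ring_1 mpoly)
     (Poly_Mapping.single (Ind 0) (Suc 0)) = adj_mat G u v"
  \<comment> \<open>The double sum becomes a single sum over pairs, to which
    \<open>lookup_add_sum\<close> applies.\<close>
  unfolding mat_all_blocks_def sum.cartesian_product case_prod_unfold
  by (subst lookup_add_sum[OF adj_mat_01]) (simp_all add: J_mat_01 adj_mat_def del: insert_iff)

theorem theorem3p5:
  fixes G H :: "'v pair_pre_digraph" and V :: "'v set"
    and p :: nat and P :: "nat \<Rightarrow> 'v set"
    and A B :: "'v \<Rightarrow> 'v \<Rightarrow> 'k::comm_ring_1"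
    and A\<^sub>s B\<^sub>s :: "'v \<Rightarrow> 'v \<Rightarrow> 'k mpoly"
  assumes "pair_graph G" and "pair_graph H"
    and "pverts G = V" and "pverts H = V"
    and "\<forall>v\<in>V. deg G v = deg H v"
    and "bij_betw P {1..p} (degree_classes G)"
    and "A = adj_mat G" and "B = adj_mat H"
    and "A\<^sub>s = adj_mat G" and "B\<^sub>s = adj_mat H"
  shows "(wl_series V A = wl_series V B \<longleftrightarrow>
            wl_series V (mat_diag p P A\<^sub>s) = wl_series V (mat_diag p P B\<^sub>s))
       \<and> (wl_series V A = wl_series V B \<longleftrightarrow>
            wl_series V (mat_diag_blocks p P A\<^sub>s) = wl_series V (mat_diag_blocks p P B\<^sub>s))
       \<and> (wl_series V A = wl_series V B \<longleftrightarrow>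
            wl_series V (mat_all_blocks p P A\<^sub>s) = wl_series V (mat_all_blocks p P B\<^sub>s))"
proof -
  interpret pair_graph G by fact
  have finV: "finite V" using assms(3) finite_verts by simp
  let ?R = "\<lambda>u u'. \<forall>i\<in>{1..p}. u \<in> P i \<longleftrightarrow> u' \<in> P i"
  have R: "?R u u'" if "u \<in> V" "u' \<in> V" "deg G u = deg H u'" for u u'
  proof
    fix i assume "i \<in> {1..p}"
    then have "P i \<in> degree_classes G" using assms(6) by (auto dest: bij_betwE)
    \<comment> \<open>By the assumption of equal degrees, \<open>deg H u'\<close> is
      \<open>deg G u'\<close>. Thus the parts, built from \<open>G\<close>, are also the degree
      classes of \<open>H\<close>.\<close>
    then show "u \<in> P i \<longleftrightarrow> u' \<in> P i"
      using that assms(3,5) by (intro mem_degree_class_iff[of _ G]) auto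
  qed
  have forward: "wl_series V N = wl_series V N'"
    if eq: "wl_series V A = wl_series V B"
      and N: "\<And>u v u' v'. \<lbrakk>u = v \<longleftrightarrow> u' = v'; A\<^sub>s u v = B\<^sub>s u' v'; ?R u u'; ?R v v'\<rbrakk>
        \<Longrightarrow> N u v = N' u' v'"
    for N N' :: "'v \<Rightarrow> 'v \<Rightarrow> 'k mpoly"
  proof -
    interpret wl_simulation V A B N N' ?R
    proof
      show "?R u u' \<and> ?R v v'"
        if "u \<in> V" "v \<in> V" "u' \<in> V" "v' \<in> V" "wl_coloring V A 1 u v = wl_coloring V B 1 u' v'"
        for u v u' v'
        using that R deg_eq_if_wl_coloring_eq[OF assms(1-4), of u v u' v'] assms(7,8) by blast
      show "N u v = N' u' v'"
        if "u = v \<longleftrightarrow> u' = v'" "A u v = B u' v'" "?R u u'" "?R v v'" for u v u' v'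
      proof (rule N)
        \<comment> \<open>Both versions of an adjacency matrix have entries 0 and 1, so an equality
          of entries passes from \<open>'k\<close> to the polynomial ring.\<close>
        show "A\<^sub>s u v = B\<^sub>s u' v'"
          using that(2) assms(7-10) by (simp add: adj_mat_def split: if_splits)
      qed (fact that)+
    qed (fact finV)
    show ?thesis using eq by (rule wl_series_eq)
  qed
  have backward: "wl_series V A = wl_series V B"
    if "wl_series V N = wl_series V N'"
      and "\<And>u v. Poly_Mapping.lookup (N u v) (Poly_Mapping.single (Ind 0) (Suc 0)) = A u v"
      and "\<And>u v. Poly_Mapping.lookup (N' u v) (Poly_Mapping.single (Ind 0) (Suc 0)) = B u v"
    for N N' :: "'v \<Rightarrow> 'v \<Rightarrow> 'k mpoly"
  proof -
    \<comment> \<open>The coefficient of the monomial of \<open>Ind 0\<close> alone gives back the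
      adjacency entry, so the relation on vertices is taken to be constantly true.\<close>
    interpret wl_simulation V N N' A B "\<lambda>_ _. True"
      by standard (auto simp: finV simp flip: that(2,3))
    show ?thesis using that(1) by (rule wl_series_eq)
  qed
  have J: "J_mat P i j u v = (J_mat P i j u' v' :: 'k mpoly)"
    if "?R u u'" "?R v v'" "i \<in> {1..p}" "j \<in> {1..p}" for i j u v u' v'
    using that by (simp add: J_mat_def char_vec_def)
  have D: "D_mat P i u v = (D_mat P i u' v' :: 'k mpoly)"
    if "u = v \<longleftrightarrow> u' = v'" "?R v v'" "i \<in> {1..p}" for i u v u' v'
    using that by (auto simp add: D_mat_def)
  have "wl_series V A = wl_series V B \<longleftrightarrow>
      wl_series V (mat_diag p P A\<^sub>s) = wl_series V (mat_diag p P B\<^sub>s)"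
  proof
    show "wl_series V (mat_diag p P A\<^sub>s) = wl_series V (mat_diag p P B\<^sub>s)"
      if eq: "wl_series V A = wl_series V B"
    proof (rule forward[OF eq])
      show "mat_diag p P A\<^sub>s u v = mat_diag p P B\<^sub>s u' v'"
        if "u = v \<longleftrightarrow> u' = v'" "A\<^sub>s u v = B\<^sub>s u' v'" "?R v v'" for u v u' v'
        \<comment> \<open>The terms at \<open>Ind 0\<close> agree by the assumption on the entries,
          and the sums agree term by term.\<close>
        unfolding mat_diag_def that(2) using D[OF that(1,3)] by simp
    qed
  qed (erule backward; simp add: assms(7-10) lookup_mat_diag)
  moreover have "wl_series V A = wl_series V B \<longleftrightarrow>
      wl_series V (mat_diag_blocks p P A\<^sub>s) = wl_series V (mat_diag_blocks p P B\<^sub>s)"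
  proof
    show "wl_series V (mat_diag_blocks p P A\<^sub>s) = wl_series V (mat_diag_blocks p P B\<^sub>s)"
      if eq: "wl_series V A = wl_series V B"
    proof (rule forward[OF eq])
      show "mat_diag_blocks p P A\<^sub>s u v = mat_diag_blocks p P B\<^sub>s u' v'"
        if "A\<^sub>s u v = B\<^sub>s u' v'" "?R u u'" "?R v v'" for u v u' v'
        unfolding mat_diag_blocks_def that(1) using J[OF that(2,3)] by simp
    qed
  qed (erule backward; simp add: assms(7-10) lookup_mat_diag_blocks)
  moreover have "wl_series V A = wl_series V B \<longleftrightarrow>
      wl_series V (mat_all_blocks p P A\<^sub>s) = wl_series V (mat_all_blocks p P B\<^sub>s)"
  proof
    show "wl_series V (mat_all_blocks p P A\<^sub>s) = wl_series V (mat_all_blocks p P B\<^sub>s)"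
      if eq: "wl_series V A = wl_series V B"
    proof (rule forward[OF eq])
      show "mat_all_blocks p P A\<^sub>s u v = mat_all_blocks p P B\<^sub>s u' v'"
        if "A\<^sub>s u v = B\<^sub>s u' v'" "?R u u'" "?R v v'" for u v u' v'
        unfolding mat_all_blocks_def that(1) using J[OF that(2,3)] by simp
    qed
  qed (erule backward; simp add: assms(7-10) lookup_mat_all_blocks)
  ultimately show ?thesis by blast
qed

end
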